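(* Let $r>0$ and let $\mathcal{P}=\sum_{i\in\mathbb{N}}p_i\,u_i\otimes u_i\in S^\infty(U)$ be a monotonic Schmidt decomposition with respect to the $U$-orthonormal basis $\{u_i\}_{i\in\mathbb{N}}$ of eigenfunctions of the compact, self-adjoint operator $T$. Let $\mathcal{P}_n:=\sum_{1\le i\le n-1}p_i\,u_i\otimes u_i$. If $\mathcal{P}f\in A^{r,2}_\lambda(U)$, then $$\|(\mathcal{P}-\mathcal{P}_n)f\|_U\lesssim \lambda_n^{r/2}\,|\mathcal{P}f|_{A^{r,2}_\lambda(U)}.$$ This bound holds in particular in the two cases: 1) $\mathcal{P}\in\mathcal{L}(U)$ and $f\in A^{r,2}_\lambda(U)$; 2) $\mathcal{P}\in\mathbb{A}^{r,2}_\lambda(U)$ and $f\in U$ (that is, in each of these cases $\mathcal{P}f\in A^{r,2}_\lambda(U)$). Suppose moreover that the eigenvalues are quasigeometric, in that there are two constants $c_1,c_2$ with $1<c_1\le \lambda_{n_{j-1}}/\lambda_{n_j}\le c_2$ for all $j\in\mathbb{N}$, where $\{n_j\}_{j\in\mathbb{N}_0}$ is a quasigeometric sequence of integers. Then for $s>r>0$ and $\mathcal{P}\in\mathbb{A}^{s,2}_\lambda(U)$, $$|\mathcal{P}-\mathcal{P}_{n_j}|_{\mathbb{A}^{r,2}_\lambda(U)}\le \lambda_{n_j}^{(s-r)/2}\,|\mathcal{P}|_{\mathbb{A}^{s,2}_\lambda(U)}.$$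
   Context: $U=L^2_\mu(\Omega)$ is a real separable Hilbert space; $\mathcal{L}(U)$ denotes bounded and $S^\infty(U)$ compact linear operators on $U$; $(u\otimes v)f:=u\,(v,f)_U$. $T:U\to U$ is a fixed compact self-adjoint operator with nonzero eigenvalues in nonincreasing order $\lambda_1\ge\lambda_2\ge\dots>0$ (accumulating only at $0$) and eigenfunctions $\{u_i\}_{i\in\mathbb{N}}$ forming an orthonormal basis of $U$. "Monotonic Schmidt decomposition" means that the real coefficients $p_i$ are nonincreasing, $p_1\ge p_2\ge\dots\ge 0$. For $r>0$, $$A^{r,2}_\lambda(U):=\Big\{f\in U\;\Big|\;|f|^2_{A^{r,2}_\lambda(U)}:=\sum_{i}\lambda_i^{-r}|(u_i,f)_U|^2<\infty\Big\},$$ $$\mathbb{A}^{r,2}_\lambda(U):=\Big\{\mathcal{P}=\sum_{i}p_i\,u_i\otimes u_i\in S^\infty(U)\;\Big|\; |\mathcal{P}|^2_{\mathbb{A}^{r,2}_\lambda(U)}:=\sum_{i}\lambda_i^{-r}|p_i|^2<\infty\Big\}.$$ A sequence of positive integers $\{n_j\}_{j\in\mathbb{N}_0}$ is quasigeometric if $n_0=1$ and there are constants $a,b$ with $1<a\le n_{j+1}/n_j\le b<\infty$ for all $j$. $a\lesssim b$ means $a\le c\,b$ with a constant $c>0$ independent of $f$ and $n$. *)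

theory Defs
  imports "HOL-Analysis.Analysis"
begin

text \<open>
  The space U is an arbitrary type of sort {real_inner, polish_space}, i.e. a real separable Hilbert
  space; the spaces of square integrable functions are the instances of interest. Elements of
  \<open>'a \<Rightarrow>\<^sub>L 'a\<close> are the bounded linear operators on U. All sequences of basis vectors, eigenvalues
  and coefficients are indexed by the positive integers; their value at index 0 is irrelevant.
\<close>

definition compact_operator :: "('a::real_normed_vector \<Rightarrow>\<^sub>L 'b::real_normed_vector) \<Rightarrow> bool" where
  "compact_operator T \<longleftrightarrow> compact (closure (blinfun_apply T ` cball 0 1))"

definition self_adjoint :: "('a::real_inner \<Rightarrow>\<^sub>L 'a) \<Rightarrow> bool" where
  "self_adjoint T \<longleftrightarrow> (\<forall>f g. T f \<bullet> g = f \<bullet> T g)"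

lift_definition tensor :: "'a::real_inner \<Rightarrow> 'a \<Rightarrow> 'a \<Rightarrow>\<^sub>L 'a"
  is "\<lambda>u v f. (v \<bullet> f) *\<^sub>R u"
  by (intro bounded_linear_scaleR_left[THEN bounded_linear_compose] bounded_linear_inner_right)

definition orthonormal_basis :: "(nat \<Rightarrow> 'a::real_inner) \<Rightarrow> bool" where
  "orthonormal_basis u \<longleftrightarrow>
     (\<forall>i\<ge>1. \<forall>j\<ge>1. u i \<bullet> u j = (if i = j then 1 else 0)) \<and>
     closure (span (u ` {1..})) = UNIV"

definition eigensystem ::
  "('a::real_inner \<Rightarrow>\<^sub>L 'a) \<Rightarrow> (nat \<Rightarrow> real) \<Rightarrow> (nat \<Rightarrow> 'a) \<Rightarrow> bool" where
  "eigensystem T lam u \<longleftrightarrow>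
     compact_operator T \<and> self_adjoint T \<and> orthonormal_basis u \<and>
     (\<forall>i\<ge>1. T (u i) = lam i *\<^sub>R u i) \<and>
     (\<forall>i\<ge>1. 0 < lam i) \<and> antimono_on {1..} lam \<and> lam \<longlonglongrightarrow> 0"

text \<open>
  \<open>P = \<Sum>i. p i *\<^sub>R tensor (u i) (u i)\<close>, with convergence in the strong operator topology. This also
  makes sense for bounded non-compact P. If P is compact and u is orthonormal, the coefficients tend
  to 0 and the convergence is automatically in operator norm. By orthogonality, summation over the
  net of finite subsets agrees with ordinary summation of the series.
\<close>

definition schmidt ::
  "(nat \<Rightarrow> 'a::real_inner) \<Rightarrow> (nat \<Rightarrow> real) \<Rightarrow> ('a \<Rightarrow>\<^sub>L 'a) \<Rightarrow> bool" where
  "schmidt u p P \<longleftrightarrow> (\<forall>f. ((\<lambda>i. (p i *\<^sub>R tensor (u i) (u i)) f) has_sum P f) {1..})"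

definition monotonic_schmidt ::
  "(nat \<Rightarrow> 'a::real_inner) \<Rightarrow> (nat \<Rightarrow> real) \<Rightarrow> ('a \<Rightarrow>\<^sub>L 'a) \<Rightarrow> bool" where
  "monotonic_schmidt u p P \<longleftrightarrow>
     schmidt u p P \<and> antimono_on {1..} p \<and> (\<forall>i\<ge>1. 0 \<le> p i)"

definition schmidt_trunc ::
  "(nat \<Rightarrow> 'a::real_inner) \<Rightarrow> (nat \<Rightarrow> real) \<Rightarrow> nat \<Rightarrow> 'a \<Rightarrow>\<^sub>L 'a" where
  "schmidt_trunc u p n = (\<Sum>i\<in>{1..n - 1}. p i *\<^sub>R tensor (u i) (u i))"

definition approx_space ::
  "(nat \<Rightarrow> real) \<Rightarrow> (nat \<Rightarrow> 'a::real_inner) \<Rightarrow> real \<Rightarrow> 'a set" where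
  "approx_space lam u r = {f. (\<lambda>i. lam i powr (- r) * \<bar>u i \<bullet> f\<bar>\<^sup>2) summable_on {1..}}"

definition approx_seminorm ::
  "(nat \<Rightarrow> real) \<Rightarrow> (nat \<Rightarrow> 'a::real_inner) \<Rightarrow> real \<Rightarrow> 'a \<Rightarrow> real" where
  "approx_seminorm lam u r f = sqrt (\<Sum>\<^sub>\<infinity>i\<in>{1..}. lam i powr (- r) * \<bar>u i \<bullet> f\<bar>\<^sup>2)"

definition op_approx_space ::
  "(nat \<Rightarrow> real) \<Rightarrow> (nat \<Rightarrow> 'a::real_inner) \<Rightarrow> real \<Rightarrow> ('a \<Rightarrow>\<^sub>L 'a) set" where
  "op_approx_space lam u r =
     {P. compact_operator P \<and>
         (\<exists>p. schmidt u p P \<and> (\<lambda>i. lam i powr (- r) * \<bar>p i\<bar>\<^sup>2) summable_on {1..})}"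

text \<open>For orthonormal u the coefficients of P are unique up to the irrelevant index 0; see
  \<open>schmidt_coeff_eq\<close>.\<close>

definition schmidt_coeff ::
  "(nat \<Rightarrow> 'a::real_inner) \<Rightarrow> ('a \<Rightarrow>\<^sub>L 'a) \<Rightarrow> nat \<Rightarrow> real" where
  "schmidt_coeff u P = (SOME p. schmidt u p P)"

definition op_approx_seminorm ::
  "(nat \<Rightarrow> real) \<Rightarrow> (nat \<Rightarrow> 'a::real_inner) \<Rightarrow> real \<Rightarrow> ('a \<Rightarrow>\<^sub>L 'a) \<Rightarrow> real" where
  "op_approx_seminorm lam u r P =
     sqrt (\<Sum>\<^sub>\<infinity>i\<in>{1..}. lam i powr (- r) * \<bar>schmidt_coeff u P i\<bar>\<^sup>2)"

definition quasigeometric :: "(nat \<Rightarrow> nat) \<Rightarrow> bool" where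
  "quasigeometric n \<longleftrightarrow>
     n 0 = 1 \<and> (\<forall>j. 0 < n j) \<and>
     (\<exists>a b. 1 < a \<and> (\<forall>j. a \<le> real (n (Suc j)) / real (n j) \<and> real (n (Suc j)) / real (n j) \<le> b))"

lemma schmidt_imp_coeff:
  fixes u :: "nat \<Rightarrow> 'a::real_inner"
  assumes u: "orthonormal_basis u" and P: "schmidt u p P" and i: "i \<ge> 1"
  shows "u i \<bullet> P (u i) = p i"
proof -
  have on: "u k \<bullet> u j = (if k = j then 1 else 0)" if "k \<ge> 1" "j \<ge> 1" for k j
    using u that by (auto simp: orthonormal_basis_def)
  have "((\<lambda>k. (p k *\<^sub>R tensor (u k) (u k)) (u i)) has_sum P (u i)) {1..}"
    using P by (auto simp: schmidt_def)
  then have sum_P: "((\<lambda>k. u i \<bullet> ((p k *\<^sub>R tensor (u k) (u k)) (u i))) has_sum (u i \<bullet> P (u i))) {1..}"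
    by (rule has_sum_bounded_linear[OF bounded_linear_inner_right])
  have summand: "u i \<bullet> ((p k *\<^sub>R tensor (u k) (u k)) (u i)) = (if k = i then p i else 0)"
    if "k \<in> {1..}" for k
    using i that on[of k i] on[of i k] by (auto simp: scaleR_blinfun.rep_eq tensor.rep_eq)
  have "((\<lambda>k. if k = i then p i else 0) has_sum p i) {i}"
    using has_sum_finite[of "{i}" "\<lambda>k. if k = i then p i else 0"] by simp
  then have "((\<lambda>k. if k = i then p i else 0) has_sum p i) {1..}"
    by (rule has_sum_cong_neutral[THEN iffD1, rotated 3]) (use i in auto)
  then have "((\<lambda>k. u i \<bullet> ((p k *\<^sub>R tensor (u k) (u k)) (u i))) has_sum p i) {1..}"
    by (rule has_sum_cong[THEN iffD2, rotated]) (rule summand)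
  with sum_P show ?thesis
    by (rule has_sum_unique)
qed

lemma schmidt_coeff_eq:
  fixes u :: "nat \<Rightarrow> 'a::real_inner"
  assumes u: "orthonormal_basis u" and P: "schmidt u p P" and i: "i \<ge> 1"
  shows "schmidt_coeff u P i = p i"
proof -
  have "schmidt u (schmidt_coeff u P) P"
    unfolding schmidt_coeff_def by (rule someI[of "\<lambda>p. schmidt u p P", OF P])
  then show ?thesis
    using schmidt_imp_coeff[OF u _ i] P by metis
qed

end

theory Submission
  imports Defs
begin

text \<open>
  In the basis \<open>u\<close> everything is diagonal. If \<open>P\<close> has Schmidt coefficients \<open>p\<close>, then \<open>P f\<close> has Fourier
  coefficients \<open>x i = p i * (u i \<bullet> f)\<close>, and the remainder \<open>P - schmidt_trunc u p n\<close> is again a Schmidt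
  decomposition, with the coefficients below \<open>n\<close> replaced by 0 (\<open>schmidt_remainder\<close>). By orthogonality
  the squared norm of a value of such an operator is the sum of the squared coefficients
  (\<open>schmidt_norm_has_sum\<close>). Both estimates are therefore one and the same inequality for scalar
  series, \<open>weighted_tail_le\<close>: since \<open>lam i \<le> lam n\<close> for \<open>i \<ge> n\<close>,

  \<open>\<Sum>i\<ge>n. lam i powr (- r) * (x i)\<^sup>2 \<le> lam n powr (s - r) * (\<Sum>i\<ge>1. lam i powr (- s) * (x i)\<^sup>2)\<close>

  whenever \<open>r \<le> s\<close>. The estimate for functions is the case where the two exponents are 0 and \<open>r\<close> and
  \<open>x\<close> are the Fourier coefficients of \<open>P f\<close>; the constant is 1. The estimate for operators is the case
  where \<open>x\<close> are the Schmidt coefficients of \<open>Q\<close>.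

  That \<open>P f\<close> lies in the approximation space follows by comparing terms: either \<open>p\<close> is bounded by
  \<open>p 1\<close>, by monotonicity, or \<open>(u i \<bullet> f)\<^sup>2\<close> is bounded by the squared norm of \<open>f\<close>. Finally the remainder
  of a compact operator is compact, because compact operators form a vector space that contains
  every \<open>tensor u v\<close>.
\<close>

section \<open>Compact operators\<close>

text \<open>A compact set that contains the image of the unit ball suffices, as it contains its closure too.\<close>

lemma compact_operatorI:
  fixes T :: "'a::real_normed_vector \<Rightarrow>\<^sub>L 'b::real_normed_vector"
  assumes "compact K" and "T ` cball 0 1 \<subseteq> K"
  shows "compact_operator T"
proof -
  have "closure (T ` cball 0 1) \<subseteq> K"
    using assms by (intro closure_minimal compact_imp_closed)
  then have "compact (K \<inter> closure (T ` cball 0 1))"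
    using assms(1) by (intro compact_Int_closed) auto
  then show ?thesis
    using \<open>closure (T ` cball 0 1) \<subseteq> K\<close> by (simp add: compact_operator_def inf_absorb2)
qed

lemma compact_operator_zero: "compact_operator 0"
  by (rule compact_operatorI[of "{0}"]) auto

lemma compact_operator_add:
  fixes A B :: "'a::real_normed_vector \<Rightarrow>\<^sub>L 'b::real_normed_vector"
  assumes "compact_operator A" and "compact_operator B"
  shows "compact_operator (A + B)"
proof (rule compact_operatorI)
  show "compact {x + y |x y. x \<in> closure (A ` cball 0 1) \<and> y \<in> closure (B ` cball 0 1)}"
    using assms unfolding compact_operator_def by (rule compact_sums)
  show "(A + B) ` cball 0 1 \<subseteq>
      {x + y |x y. x \<in> closure (A ` cball 0 1) \<and> y \<in> closure (B ` cball 0 1)}"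
  proof (rule image_subsetI)
    fix f :: 'a assume "f \<in> cball 0 1"
    then have "A f \<in> closure (A ` cball 0 1)" and "B f \<in> closure (B ` cball 0 1)"
      by (intro closure_subset[THEN subsetD] imageI; assumption)+
    then show "(A + B) f \<in>
        {x + y |x y. x \<in> closure (A ` cball 0 1) \<and> y \<in> closure (B ` cball 0 1)}"
      unfolding plus_blinfun.rep_eq by blast
  qed
qed

lemma compact_operator_scaleR:
  assumes "compact_operator A"
  shows "compact_operator (c *\<^sub>R A)"
proof (rule compact_operatorI)
  show "compact ((*\<^sub>R) c ` closure (A ` cball 0 1))"
    using assms unfolding compact_operator_def by (rule compact_scaling)
  show "(c *\<^sub>R A) ` cball 0 1 \<subseteq> (*\<^sub>R) c ` closure (A ` cball 0 1)"
    using closure_subset[of "A ` cball 0 1"] by (auto simp: scaleR_blinfun.rep_eq)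
qed

lemma compact_operator_diff:
  assumes "compact_operator A" and "compact_operator B"
  shows "compact_operator (A - B)"
  using compact_operator_add[OF assms(1) compact_operator_scaleR[OF assms(2), of "-1"]] by simp

lemma compact_operator_sum:
  assumes "\<And>i. i \<in> I \<Longrightarrow> compact_operator (A i)"
  shows "compact_operator (sum A I)"
  using assms
  by (induction I rule: infinite_finite_induct)
     (auto intro: compact_operator_zero compact_operator_add)

text \<open>By the Cauchy-Schwarz inequality the unit ball is mapped into a segment on the line through \<open>u\<close>.\<close>

lemma compact_operator_tensor: "compact_operator (tensor u v)"
proof (rule compact_operatorI)
  show "compact ((\<lambda>t. t *\<^sub>R u) ` {- norm v..norm v})"
    by (intro compact_continuous_image continuous_intros) auto
  show "tensor u v ` cball 0 1 \<subseteq> (\<lambda>t. t *\<^sub>R u) ` {- norm v..norm v}"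
  proof
    fix y assume "y \<in> tensor u v ` cball 0 1"
    then obtain f where f: "norm f \<le> 1" and y: "y = (v \<bullet> f) *\<^sub>R u"
      by (auto simp: tensor.rep_eq)
    have "\<bar>v \<bullet> f\<bar> \<le> norm v * norm f"
      by (rule Cauchy_Schwarz_ineq2)
    also have "\<dots> \<le> norm v"
      using f by (simp add: mult_left_le)
    finally show "y \<in> (\<lambda>t. t *\<^sub>R u) ` {- norm v..norm v}"
      unfolding y by (intro imageI) auto
  qed
qed

lemma compact_operator_schmidt_trunc: "compact_operator (schmidt_trunc u p n)"
  unfolding schmidt_trunc_def
  by (intro compact_operator_sum compact_operator_scaleR compact_operator_tensor)

section \<open>Schmidt decompositions\<close>

lemma orthonormal_basis_inner:
  assumes "orthonormal_basis u" and "i \<ge> 1" and "j \<ge> 1"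
  shows "u i \<bullet> u j = (if i = j then 1 else 0)"
  using assms by (auto simp: orthonormal_basis_def)

lemma schmidt_has_sum:
  assumes "schmidt u p P"
  shows "((\<lambda>i. (p i * (u i \<bullet> f)) *\<^sub>R u i) has_sum P f) {1..}"
  using assms by (simp add: schmidt_def scaleR_blinfun.rep_eq tensor.rep_eq)

lemma schmidt_unique:
  assumes "orthonormal_basis u" and "schmidt u p P" and "schmidt u q P" and "i \<ge> 1"
  shows "p i = q i"
  using assms by (metis schmidt_imp_coeff)

text \<open>Only the summand with index \<open>i\<close> has a component along \<open>u i\<close>.\<close>

lemma schmidt_inner:
  assumes u: "orthonormal_basis u" and P: "schmidt u p P" and i: "i \<ge> 1"
  shows "u i \<bullet> P f = p i * (u i \<bullet> f)"
proof -
  have "((\<lambda>k. u i \<bullet> ((p k * (u k \<bullet> f)) *\<^sub>R u k)) has_sum (u i \<bullet> P f)) {1..}"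
    by (rule has_sum_bounded_linear[OF bounded_linear_inner_right schmidt_has_sum[OF P]])
  also have "?this \<longleftrightarrow> ((\<lambda>k. p i * (u i \<bullet> f)) has_sum (u i \<bullet> P f)) {i}"
    using i by (intro has_sum_cong_neutral) (auto simp: orthonormal_basis_inner[OF u])
  finally have "((\<lambda>k. p i * (u i \<bullet> f)) has_sum (u i \<bullet> P f)) {i}" .
  moreover have "((\<lambda>k. p i * (u i \<bullet> f)) has_sum (p i * (u i \<bullet> f))) {i}"
    using has_sum_finite[of "{i}" "\<lambda>k. p i * (u i \<bullet> f)"] by simp
  ultimately show ?thesis
    by (rule has_sum_unique)
qed

text \<open>
  This is Parseval's identity for the vectors in the range of \<open>P\<close>. Since \<open>P f\<close> is given as an
  orthogonal series, it suffices to take the inner product of that series with \<open>P f\<close>.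
\<close>

lemma schmidt_norm_has_sum:
  assumes u: "orthonormal_basis u" and P: "schmidt u p P"
  shows "((\<lambda>i. (p i * (u i \<bullet> f))\<^sup>2) has_sum (norm (P f))\<^sup>2) {1..}"
proof -
  have "((\<lambda>i. P f \<bullet> ((p i * (u i \<bullet> f)) *\<^sub>R u i)) has_sum (P f \<bullet> P f)) {1..}"
    by (rule has_sum_bounded_linear[OF bounded_linear_inner_right schmidt_has_sum[OF P]])
  moreover have "P f \<bullet> ((p i * (u i \<bullet> f)) *\<^sub>R u i) = (p i * (u i \<bullet> f))\<^sup>2" if "i \<in> {1..}" for i
    using schmidt_inner[OF u P, of i f] that
    by (simp add: inner_commute power2_eq_square)
  ultimately have "((\<lambda>i. (p i * (u i \<bullet> f))\<^sup>2) has_sum (P f \<bullet> P f)) {1..}"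
    by (rule has_sum_cong[THEN iffD1, rotated])
  then show ?thesis
    by (simp add: power2_norm_eq_inner)
qed

lemma schmidt_remainder:
  assumes P: "schmidt u p P"
  shows "schmidt u (\<lambda>i. if n \<le> i then p i else 0) (P - schmidt_trunc u p n)"
  unfolding schmidt_def
proof
  fix f
  let ?F = "\<lambda>i. (p i *\<^sub>R tensor (u i) (u i)) f"
  have "(?F has_sum schmidt_trunc u p n f) {1..n - 1}"
    using has_sum_finite[of "{1..n - 1}" ?F] by (simp add: schmidt_trunc_def blinfun.sum_left)
  moreover have "(?F has_sum P f) {1..}"
    using P by (simp add: schmidt_def)
  ultimately have "(?F has_sum (P f - schmidt_trunc u p n f)) ({1..} - {1..n - 1})"
    by (intro has_sum_Diff) auto
  also have "?this \<longleftrightarrow> ((\<lambda>i. ((if n \<le> i then p i else 0) *\<^sub>R tensor (u i) (u i)) f)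
      has_sum (P f - schmidt_trunc u p n f)) {1..}"
    by (intro has_sum_cong_neutral) auto
  finally show "((\<lambda>i. ((if n \<le> i then p i else 0) *\<^sub>R tensor (u i) (u i)) f)
      has_sum (P - schmidt_trunc u p n) f) {1..}"
    by (simp add: minus_blinfun.rep_eq)
qed

section \<open>Tails of weighted series\<close>

text \<open>
  For \<open>i \<ge> n\<close> the weight factors as
  \<open>lam i powr (- r) = lam i powr (s - r) * lam i powr (- s) \<le> lam n powr (s - r) * lam i powr (- s)\<close>;
  the terms with \<open>i < n\<close> vanish on the left.
\<close>

lemma weighted_tail_le:
  fixes lam x :: "nat \<Rightarrow> real"
  assumes pos: "\<And>i. i \<ge> 1 \<Longrightarrow> 0 < lam i" and mono: "antimono_on {1..} lam"
    and "r \<le> s" and n: "n \<ge> 1"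
    and sum: "(\<lambda>i. lam i powr (- s) * \<bar>x i\<bar>\<^sup>2) summable_on {1..}"
  shows "(\<lambda>i. lam i powr (- r) * \<bar>if n \<le> i then x i else 0\<bar>\<^sup>2) summable_on {1..}"
    and "(\<Sum>\<^sub>\<infinity>i\<in>{1..}. lam i powr (- r) * \<bar>if n \<le> i then x i else 0\<bar>\<^sup>2)
           \<le> lam n powr (s - r) * (\<Sum>\<^sub>\<infinity>i\<in>{1..}. lam i powr (- s) * \<bar>x i\<bar>\<^sup>2)"
proof -
  let ?L = "\<lambda>i. lam i powr (- r) * \<bar>if n \<le> i then x i else 0\<bar>\<^sup>2"
  let ?R = "\<lambda>i. lam n powr (s - r) * (lam i powr (- s) * \<bar>x i\<bar>\<^sup>2)"
  have le: "?L i \<le> ?R i" if i: "i \<in> {1..}" for i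
  proof (cases "n \<le> i")
    case True
    have "lam i \<le> lam n"
      using monotone_onD[OF mono, of n i] i n True by auto
    have "lam i powr (- r) = lam i powr (s - r) * lam i powr (- s)"
      by (simp flip: powr_add)
    also have "\<dots> \<le> lam n powr (s - r) * lam i powr (- s)"
      using \<open>lam i \<le> lam n\<close> pos[of i] i \<open>r \<le> s\<close> by (intro mult_right_mono powr_mono2) auto
    finally have "lam i powr (- r) * \<bar>x i\<bar>\<^sup>2 \<le> lam n powr (s - r) * lam i powr (- s) * \<bar>x i\<bar>\<^sup>2"
      by (rule mult_right_mono) simp
    then show ?thesis
      using True by (simp add: mult.assoc)
  qed simp
  have sum': "?R summable_on {1..}"
    by (rule summable_on_cmult_right[OF sum])
  show summable: "?L summable_on {1..}"
    by (rule summable_on_comparison_test[OF sum' le]) auto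
  have "infsum ?L {1..} \<le> infsum ?R {1..}"
    by (rule infsum_mono[OF summable sum' le])
  then show "infsum ?L {1..} \<le> lam n powr (s - r) * (\<Sum>\<^sub>\<infinity>i\<in>{1..}. lam i powr (- s) * \<bar>x i\<bar>\<^sup>2)"
    by (simp add: infsum_cmult_right')
qed

lemma sqrt_powr_mult:
  assumes "0 \<le> a"
  shows "sqrt (a powr t * b) = a powr (t / 2) * sqrt b"
  using assms by (simp add: real_sqrt_mult powr_half_sqrt_powr)

section \<open>Approximation spaces\<close>

lemma schmidt_remainder_norm_le:
  assumes E: "eigensystem T lam u" and "0 < r" and P: "schmidt u p P" and n: "n \<ge> 1"
    and Pf: "P f \<in> approx_space lam u r"
  shows "norm ((P - schmidt_trunc u p n) f) \<le> lam n powr (r / 2) * approx_seminorm lam u r (P f)"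
proof -
  have u: "orthonormal_basis u" and pos: "\<And>i. i \<ge> 1 \<Longrightarrow> 0 < lam i"
    and mono: "antimono_on {1..} lam"
    using E by (auto simp: eigensystem_def)
  let ?x = "\<lambda>i. u i \<bullet> P f"
  have "((\<lambda>i. ((if n \<le> i then p i else 0) * (u i \<bullet> f))\<^sup>2)
      has_sum (norm ((P - schmidt_trunc u p n) f))\<^sup>2) {1..}"
    by (rule schmidt_norm_has_sum[OF u schmidt_remainder[OF P]])
  \<comment> \<open>The exponent 0 turns the plain sum of squares into a weighted one.\<close>
  also have "?this \<longleftrightarrow> ((\<lambda>i. lam i powr (- 0) * \<bar>if n \<le> i then ?x i else 0\<bar>\<^sup>2)
      has_sum (norm ((P - schmidt_trunc u p n) f))\<^sup>2) {1..}"
  proof (intro has_sum_cong)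
    fix i :: nat assume "i \<in> {1..}"
    then show "((if n \<le> i then p i else 0) * (u i \<bullet> f))\<^sup>2
        = lam i powr (- 0) * \<bar>if n \<le> i then ?x i else 0\<bar>\<^sup>2"
      using pos[of i] schmidt_inner[OF u P, of i f] by auto
  qed
  finally have "(norm ((P - schmidt_trunc u p n) f))\<^sup>2
      = (\<Sum>\<^sub>\<infinity>i\<in>{1..}. lam i powr (- 0) * \<bar>if n \<le> i then ?x i else 0\<bar>\<^sup>2)"
    by (rule infsumI[symmetric])
  also have "\<dots> \<le> lam n powr (r - 0) * (\<Sum>\<^sub>\<infinity>i\<in>{1..}. lam i powr (- r) * \<bar>?x i\<bar>\<^sup>2)"
    using Pf \<open>0 < r\<close> by (intro weighted_tail_le pos mono n) (auto simp: approx_space_def)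
  finally have "norm ((P - schmidt_trunc u p n) f)
      \<le> sqrt (lam n powr r * (\<Sum>\<^sub>\<infinity>i\<in>{1..}. lam i powr (- r) * \<bar>?x i\<bar>\<^sup>2))"
    by (intro real_le_rsqrt) simp
  then show ?thesis
    using pos[OF n] by (simp add: approx_seminorm_def sqrt_powr_mult)
qed

lemma bounded_schmidt_approx_space:
  assumes u: "orthonormal_basis u" and P: "schmidt u p P"
    and bound: "\<And>i. i \<ge> 1 \<Longrightarrow> \<bar>p i\<bar> \<le> B"
    and f: "f \<in> approx_space lam u r"
  shows "P f \<in> approx_space lam u r"
proof -
  have "(\<lambda>i. B\<^sup>2 * (lam i powr (- r) * \<bar>u i \<bullet> f\<bar>\<^sup>2)) summable_on {1..}"
    using f by (intro summable_on_cmult_right) (simp add: approx_space_def)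
  then have "(\<lambda>i. lam i powr (- r) * \<bar>u i \<bullet> P f\<bar>\<^sup>2) summable_on {1..}"
  proof (rule summable_on_comparison_test)
    fix i :: nat assume "i \<in> {1..}"
    then have "(p i)\<^sup>2 \<le> B\<^sup>2"
      using bound[of i] by (simp add: abs_le_square_iff[symmetric])
    then have "(p i)\<^sup>2 * (lam i powr (- r) * \<bar>u i \<bullet> f\<bar>\<^sup>2) \<le> B\<^sup>2 * (lam i powr (- r) * \<bar>u i \<bullet> f\<bar>\<^sup>2)"
      by (intro mult_right_mono) auto
    then show "lam i powr (- r) * \<bar>u i \<bullet> P f\<bar>\<^sup>2 \<le> B\<^sup>2 * (lam i powr (- r) * \<bar>u i \<bullet> f\<bar>\<^sup>2)"
      using schmidt_inner[OF u P, of i f] \<open>i \<in> {1..}\<close>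
      by (simp add: power_mult_distrib mult_ac)
  qed auto
  then show ?thesis
    by (simp add: approx_space_def)
qed

lemma op_approx_space_imp_approx_space:
  assumes u: "orthonormal_basis u" and P: "P \<in> op_approx_space lam u r"
  shows "P f \<in> approx_space lam u r"
proof -
  obtain p where p: "schmidt u p P" and sum: "(\<lambda>i. lam i powr (- r) * \<bar>p i\<bar>\<^sup>2) summable_on {1..}"
    using P by (auto simp: op_approx_space_def)
  have "(\<lambda>i. (norm f)\<^sup>2 * (lam i powr (- r) * \<bar>p i\<bar>\<^sup>2)) summable_on {1..}"
    by (intro summable_on_cmult_right sum)
  then have "(\<lambda>i. lam i powr (- r) * \<bar>u i \<bullet> P f\<bar>\<^sup>2) summable_on {1..}"
  proof (rule summable_on_comparison_test)
    fix i :: nat assume i: "i \<in> {1..}"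
    then have "norm (u i) = 1"
      using orthonormal_basis_inner[OF u, of i i] by (simp add: norm_eq_1)
    then have "(u i \<bullet> f)\<^sup>2 \<le> (norm f)\<^sup>2"
      using Cauchy_Schwarz_ineq2[of "u i" f] by (simp add: abs_le_square_iff[symmetric])
    then have "(u i \<bullet> f)\<^sup>2 * (lam i powr (- r) * \<bar>p i\<bar>\<^sup>2) \<le> (norm f)\<^sup>2 * (lam i powr (- r) * \<bar>p i\<bar>\<^sup>2)"
      by (intro mult_right_mono) auto
    then show "lam i powr (- r) * \<bar>u i \<bullet> P f\<bar>\<^sup>2 \<le> (norm f)\<^sup>2 * (lam i powr (- r) * \<bar>p i\<bar>\<^sup>2)"
      using schmidt_inner[OF u p, of i f] i by (simp add: power_mult_distrib mult_ac)
  qed auto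
  then show ?thesis
    by (simp add: approx_space_def)
qed

lemma op_approx_seminorm_eq:
  assumes "orthonormal_basis u" and "schmidt u p P"
  shows "op_approx_seminorm lam u r P = sqrt (\<Sum>\<^sub>\<infinity>i\<in>{1..}. lam i powr (- r) * \<bar>p i\<bar>\<^sup>2)"
proof -
  have "(\<Sum>\<^sub>\<infinity>i\<in>{1..}. lam i powr (- r) * \<bar>schmidt_coeff u P i\<bar>\<^sup>2)
      = (\<Sum>\<^sub>\<infinity>i\<in>{1..}. lam i powr (- r) * \<bar>p i\<bar>\<^sup>2)"
    using schmidt_coeff_eq[OF assms] by (intro infsum_cong) simp
  then show ?thesis
    by (simp add: op_approx_seminorm_def)
qed

lemma schmidt_remainder_op_approx:
  assumes E: "eigensystem T lam u" and "r \<le> s" and n: "n \<ge> 1"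
    and Q: "Q \<in> op_approx_space lam u s" and q: "schmidt u q Q"
  shows "Q - schmidt_trunc u q n \<in> op_approx_space lam u r"
    and "op_approx_seminorm lam u r (Q - schmidt_trunc u q n)
           \<le> lam n powr ((s - r) / 2) * op_approx_seminorm lam u s Q"
proof -
  have u: "orthonormal_basis u" and pos: "\<And>i. i \<ge> 1 \<Longrightarrow> 0 < lam i"
    and mono: "antimono_on {1..} lam"
    using E by (auto simp: eigensystem_def)
  obtain q' where q': "schmidt u q' Q"
    and sum': "(\<lambda>i. lam i powr (- s) * \<bar>q' i\<bar>\<^sup>2) summable_on {1..}"
    and "compact_operator Q"
    using Q by (auto simp: op_approx_space_def)
  have sum: "(\<lambda>i. lam i powr (- s) * \<bar>q i\<bar>\<^sup>2) summable_on {1..}"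
    by (rule summable_on_cong[THEN iffD1, OF _ sum'])
      (simp add: schmidt_unique[OF u q q'])
  note tail = weighted_tail_le[OF pos mono \<open>r \<le> s\<close> n sum]
  note rem = schmidt_remainder[OF q, of n]
  have "compact_operator (Q - schmidt_trunc u q n)"
    by (intro compact_operator_diff compact_operator_schmidt_trunc) fact
  then show "Q - schmidt_trunc u q n \<in> op_approx_space lam u r"
    using tail(1) rem unfolding op_approx_space_def by blast
  have "op_approx_seminorm lam u r (Q - schmidt_trunc u q n)
      \<le> sqrt (lam n powr (s - r) * (\<Sum>\<^sub>\<infinity>i\<in>{1..}. lam i powr (- s) * \<bar>q i\<bar>\<^sup>2))"
    unfolding op_approx_seminorm_eq[OF u rem] by (intro real_sqrt_le_mono tail(2))
  also have "\<dots> = lam n powr ((s - r) / 2) * op_approx_seminorm lam u s Q"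
    using pos[OF n] by (simp add: op_approx_seminorm_eq[OF u q] sqrt_powr_mult)
  finally show "op_approx_seminorm lam u r (Q - schmidt_trunc u q n)
      \<le> lam n powr ((s - r) / 2) * op_approx_seminorm lam u s Q" .
qed

section \<open>Direct estimates for monotonic Schmidt decompositions\<close>

theorem theorem5p4:
  fixes T P :: "'a::{real_inner, polish_space} \<Rightarrow>\<^sub>L 'a"
    and lam p :: "nat \<Rightarrow> real" and u :: "nat \<Rightarrow> 'a" and r :: real
  assumes "eigensystem T lam u"
    and "0 < r"
    and "monotonic_schmidt u p P"
  shows
    "(compact_operator P \<longrightarrow>
        (\<exists>c>0. \<forall>f n. n \<ge> 1 \<and> P f \<in> approx_space lam u r \<longrightarrow>
           norm ((P - schmidt_trunc u p n) f)
             \<le> c * (lam n powr (r / 2) * approx_seminorm lam u r (P f)))) \<and>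
     (\<exists>c>0. \<forall>f\<in>approx_space lam u r.
        P f \<in> approx_space lam u r \<and>
        (\<forall>n\<ge>1. norm ((P - schmidt_trunc u p n) f)
             \<le> c * (lam n powr (r / 2) * approx_seminorm lam u r (P f)))) \<and>
     (P \<in> op_approx_space lam u r \<longrightarrow>
        (\<exists>c>0. \<forall>f. P f \<in> approx_space lam u r \<and>
           (\<forall>n\<ge>1. norm ((P - schmidt_trunc u p n) f)
             \<le> c * (lam n powr (r / 2) * approx_seminorm lam u r (P f))))) \<and>
     (\<forall>(\<nu> :: nat \<Rightarrow> nat) c1 c2 s Q q.
        quasigeometric \<nu> \<and> 1 < c1 \<and>
        (\<forall>j\<ge>1. c1 \<le> lam (\<nu> (j - 1)) / lam (\<nu> j) \<and> lam (\<nu> (j - 1)) / lam (\<nu> j) \<le> c2) \<and>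
        r < s \<and> Q \<in> op_approx_space lam u s \<and> schmidt u q Q \<longrightarrow>
        (\<forall>j. Q - schmidt_trunc u q (\<nu> j) \<in> op_approx_space lam u r \<and>
             op_approx_seminorm lam u r (Q - schmidt_trunc u q (\<nu> j))
               \<le> lam (\<nu> j) powr ((s - r) / 2) * op_approx_seminorm lam u s Q))"
proof -
  have u: "orthonormal_basis u"
    using assms(1) by (simp add: eigensystem_def)
  have p: "schmidt u p P" and mono: "antimono_on {1..} p" and nonneg: "\<And>i. i \<ge> 1 \<Longrightarrow> 0 \<le> p i"
    using assms(3) by (auto simp: monotonic_schmidt_def)
  have bound: "\<bar>p i\<bar> \<le> p 1" if "i \<ge> 1" for i
    using monotone_onD[OF mono, of 1 i] nonneg[OF that] that by auto
  note est = schmidt_remainder_norm_le[OF assms(1,2) p]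
  have "\<exists>c>0. \<forall>f n. n \<ge> 1 \<and> P f \<in> approx_space lam u r \<longrightarrow>
      norm ((P - schmidt_trunc u p n) f)
        \<le> c * (lam n powr (r / 2) * approx_seminorm lam u r (P f))"
    using est by (intro exI[of _ 1]) auto
  moreover have "\<exists>c>0. \<forall>f\<in>approx_space lam u r.
      P f \<in> approx_space lam u r \<and>
      (\<forall>n\<ge>1. norm ((P - schmidt_trunc u p n) f)
        \<le> c * (lam n powr (r / 2) * approx_seminorm lam u r (P f)))"
    using est bounded_schmidt_approx_space[OF u p bound] by (intro exI[of _ 1]) auto
  moreover have "\<exists>c>0. \<forall>f. P f \<in> approx_space lam u r \<and>
      (\<forall>n\<ge>1. norm ((P - schmidt_trunc u p n) f)
        \<le> c * (lam n powr (r / 2) * approx_seminorm lam u r (P f)))"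
    if "P \<in> op_approx_space lam u r"
    using est op_approx_space_imp_approx_space[OF u that] by (intro exI[of _ 1]) auto
  moreover have "Q - schmidt_trunc u q (\<nu> j) \<in> op_approx_space lam u r \<and>
      op_approx_seminorm lam u r (Q - schmidt_trunc u q (\<nu> j))
        \<le> lam (\<nu> j) powr ((s - r) / 2) * op_approx_seminorm lam u s Q"
    if "quasigeometric \<nu>" "r < s" "Q \<in> op_approx_space lam u s" "schmidt u q Q"
    for \<nu> s Q q j
  proof -
    have "\<nu> j \<ge> 1"
      using that(1) by (simp add: quasigeometric_def Suc_le_eq)
    then show ?thesis
      using schmidt_remainder_op_approx[OF assms(1) less_imp_le] that by blast
  qed
  ultimately show ?thesis
    by blast
qed

end
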